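(* Let $s,t \geq 1$ be integers and let $\beta_{s,t}$ be the type-$\beta$ comb with $s$ teeth of length $t$. Then the number of linear extensions of $\beta_{s,t}$ that avoid the pattern $213$ equals $t^{s-1}$.
   Context: A linear extension of a finite poset $P$ on a set of integers is a listing $v=[v_1,\dots,v_n]$ of all elements of $P$, each exactly once, such that whenever $a \leq_P b$, $a$ appears before $b$. For $w \in S_3$, a sequence $v$ of distinct integers contains $w$ if there are indices $i<j<k$ with $(v_i,v_j,v_k)$ in the same relative order as $(w_1,w_2,w_3)$; otherwise $v$ avoids $w$. The type-$\beta$ comb $\beta_{s,t}$ is the poset on $\{1,\dots,st\}$ whose order is generated by the relations $ct+1 \leq (c+1)t+1$ for $0 \leq c \leq s-2$ (the spine) and $ct+j \leq ct+j+1$ for $0 \leq c \leq s-1$, $1 \leq j \leq t-1$ (the teeth $\{ct+1,\dots,ct+t\}$). *)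

theory Defs
  imports Main
begin

text \<open>A finite poset is given by its carrier \<open>A\<close> and its (reflexive) order relation \<open>r\<close> on \<open>A\<close>.
  The condition \<open>i \<le> j\<close> is non-strict only because \<open>r\<close> is reflexive.\<close>

definition linear_extensions :: "'a set \<Rightarrow> 'a rel \<Rightarrow> 'a list set" where
  "linear_extensions A r =
    {v. distinct v \<and> set v = A \<and>
        (\<forall>i<length v. \<forall>j<length v. (v ! i, v ! j) \<in> r \<longrightarrow> i \<le> j)}"

definition same_relative_order :: "'a::linorder list \<Rightarrow> 'b::linorder list \<Rightarrow> bool" where
  "same_relative_order xs ys \<longleftrightarrow>
    length xs = length ys \<and>
    (\<forall>a<length xs. \<forall>b<length xs. xs ! a < xs ! b \<longleftrightarrow> ys ! a < ys ! b)"

text \<open>Patterns \<open>w\<close> are permutations of \<open>{1, 2, 3}\<close> in one-line notation.\<close>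

definition contains_pattern3 :: "'a::linorder list \<Rightarrow> nat list \<Rightarrow> bool" where
  "contains_pattern3 v w \<longleftrightarrow>
    (\<exists>i j k. i < j \<and> j < k \<and> k < length v \<and> same_relative_order [v ! i, v ! j, v ! k] w)"

definition avoids_pattern3 :: "'a::linorder list \<Rightarrow> nat list \<Rightarrow> bool" where
  "avoids_pattern3 v w \<longleftrightarrow> \<not> contains_pattern3 v w"

text \<open>The index bounds \<open>c \<le> s - 2\<close> and \<open>j \<le> t - 1\<close> are written without subtraction, which truncates on
  \<^typ>\<open>nat\<close>.\<close>

definition comb_spine :: "nat \<Rightarrow> nat \<Rightarrow> nat rel" where
  "comb_spine s t = {(c * t + 1, (c + 1) * t + 1) | c. c + 1 < s}"

definition comb_teeth :: "nat \<Rightarrow> nat \<Rightarrow> nat rel" where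
  "comb_teeth s t = {(c * t + j, c * t + j + 1) | c j. c < s \<and> 1 \<le> j \<and> j < t}"

definition comb_carrier :: "nat \<Rightarrow> nat \<Rightarrow> nat set" where
  "comb_carrier s t = {1..s * t}"

text \<open>The closure \<open>\<^sup>*\<close> is reflexive on the whole type, hence the restriction to the carrier.\<close>

definition comb_le :: "nat \<Rightarrow> nat \<Rightarrow> nat rel" where
  "comb_le s t = Restr ((comb_spine s t \<union> comb_teeth s t)\<^sup>*) (comb_carrier s t)"

lemma comb_generators_subset:
  assumes "t \<ge> 1"
  shows "comb_spine s t \<union> comb_teeth s t \<subseteq> comb_carrier s t \<times> comb_carrier s t"
proof -
  have tooth: "c * t + j \<le> s * t" if "c < s" "j \<le> t" for c j
  proof -
    have "c * t + j \<le> Suc c * t" using that by simp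
    also have "\<dots> \<le> s * t" using that by (intro mult_le_mono1) simp
    finally show ?thesis .
  qed
  show ?thesis
    using assms tooth[of _ 1] tooth[of "Suc _" 1] tooth
    by (fastforce simp: comb_spine_def comb_teeth_def comb_carrier_def)
qed

lemma comb_le_partial_order:
  assumes "t \<ge> 1"
  shows "partial_order_on (comb_carrier s t) (comb_le s t)"
proof -
  let ?g = "comb_spine s t \<union> comb_teeth s t"
  have gen_less: "a < b" if "(a, b) \<in> ?g" for a b
    using that assms by (auto simp: comb_spine_def comb_teeth_def)
  have le: "a \<le> b" if "(a, b) \<in> ?g\<^sup>*" for a b
    using that
  proof (induction rule: rtrancl_induct)
    case (step y z)
    then show ?case using gen_less[of y z] by linarith
  qed simp
  show ?thesis
    unfolding partial_order_on_def preorder_on_def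
  proof (intro conjI)
    show "comb_le s t \<subseteq> comb_carrier s t \<times> comb_carrier s t"
      by (auto simp: comb_le_def)
    show "refl_on (comb_carrier s t) (comb_le s t)"
      by (auto simp: refl_on_def comb_le_def)
    show "trans (comb_le s t)"
      by (auto simp: trans_def comb_le_def intro: rtrancl_trans)
    show "antisym (comb_le s t)"
      by (auto simp: antisym_def comb_le_def dest!: le)
  qed
qed

end

theory Submission imports Defs begin

text \<open>Let \<open>v\<close> be a 213-avoiding linear extension of the comb with \<open>s + 1 \<ge> 2\<close> teeth. Among the entries
  exceeding \<open>t\<close>, the least one, \<open>t + 1\<close>, comes first. If some \<open>j \<le> t\<close> comes after \<open>t + 1\<close>, no entry
  exceeding \<open>t + 1\<close> may come after \<open>j\<close>. Hence the entries exceeding \<open>t\<close> form a contiguous block, and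
  \<open>v\<close> is \<open>1, \<dots>, k\<close>, followed by a 213-avoiding linear extension of the comb with \<open>s\<close> teeth shifted
  by \<open>t\<close>, followed by \<open>k + 1, \<dots>, t\<close>, where \<open>1 \<le> k \<le> t\<close>. Every such \<open>v\<close> is in turn a 213-avoiding
  linear extension, so each new tooth multiplies the count by \<open>t\<close>.\<close>

section \<open>Pattern avoidance and linear extensions as conditions on pairs of entries\<close>

text \<open>The head serves as the middle value of a pattern, so each recursion step is a
  \<open>sorted_wrt\<close> condition on the tail and the library facts on append, map and filter
  apply.\<close>

primrec avoids_213 :: "'a::linorder list \<Rightarrow> bool" where
  "avoids_213 [] \<longleftrightarrow> True"
| "avoids_213 (x # xs) \<longleftrightarrow> sorted_wrt (\<lambda>a c. \<not> (a < x \<and> x < c)) xs \<and> avoids_213 xs"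

lemma avoids_213_iff_nth:
  "avoids_213 v \<longleftrightarrow>
    (\<forall>i j k. i < j \<and> j < k \<and> k < length v \<longrightarrow> \<not> (v ! j < v ! i \<and> v ! i < v ! k))"
proof (induction v)
  case (Cons x xs)
  let ?B = "\<lambda>v i j k. i < j \<and> j < k \<and> k < length v \<longrightarrow> \<not> (v ! j < v ! i \<and> v ! i < v ! k)"
  \<comment> \<open>Triples split by whether the first index is 0; the other two indices are always
    successors.\<close>
  have "(\<forall>i j k. ?B (x # xs) i j k) \<longleftrightarrow>
      (\<forall>j k. ?B (x # xs) 0 (Suc j) (Suc k)) \<and> (\<forall>i j k. ?B (x # xs) (Suc i) (Suc j) (Suc k))"
    (is "?L \<longleftrightarrow> ?R")
  proof
    assume R: ?R
    show ?L
    proof (intro allI)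
      fix i j k
      show "?B (x # xs) i j k"
      proof
        assume ijk: "i < j \<and> j < k \<and> k < length (x # xs)"
        then obtain j' k' where jk: "j = Suc j'" "k = Suc k'" by (cases j; cases k) auto
        show "\<not> ((x # xs) ! j < (x # xs) ! i \<and> (x # xs) ! i < (x # xs) ! k)"
        proof (cases i)
          case 0
          show ?thesis
            using R[THEN conjunct1, rule_format, of j' k'] ijk unfolding 0 jk by simp
        next
          case (Suc i')
          show ?thesis
            using R[THEN conjunct2, rule_format, of i' j' k'] ijk unfolding Suc jk by simp
        qed
      qed
    qed
  qed blast
  then show ?case
    using Cons by (simp add: sorted_wrt_iff_nth_less) blast
qed simp

lemma same_relative_order_213:
  "same_relative_order [x, y, z] [2, 1, 3::nat] \<longleftrightarrow> y < x \<and> x < z"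
  by (auto simp: same_relative_order_def less_Suc_eq numeral_3_eq_3)

lemma avoids_pattern3_213: "avoids_pattern3 v [2, 1, 3] \<longleftrightarrow> avoids_213 v"
  unfolding avoids_pattern3_def contains_pattern3_def same_relative_order_213 avoids_213_iff_nth
  by blast

text \<open>An occurrence straddling the cut has either one entry in \<open>xs\<close> and two in
  \<open>ys\<close>, or two in \<open>xs\<close> and one in \<open>ys\<close>; the two quantified
  conditions exclude these cases.\<close>

lemma avoids_213_append:
  "avoids_213 (xs @ ys) \<longleftrightarrow> avoids_213 xs \<and> avoids_213 ys \<and>
    (\<forall>b\<in>set xs. sorted_wrt (\<lambda>a c. \<not> (a < b \<and> b < c)) ys) \<and>
    (\<forall>c\<in>set ys. sorted_wrt (\<lambda>b a. \<not> (a < b \<and> b < c)) xs)"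
  by (induction xs) (auto simp: sorted_wrt_append)

lemma avoids_213_sorted: "sorted xs \<Longrightarrow> avoids_213 xs"
proof (induction xs)
  case (Cons x xs)
  have "sorted_wrt (\<lambda>a c. \<not> (a < x \<and> x < c)) xs"
    by (rule sorted_wrt_mono_rel[of _ "(\<le>)"]) (use Cons.prems in auto)
  with Cons show ?case by simp
qed simp

lemma sorted_wrt_if_all: "(\<And>x y. x \<in> set xs \<Longrightarrow> y \<in> set xs \<Longrightarrow> P x y) \<Longrightarrow> sorted_wrt P xs"
  by (induction xs) auto

text \<open>In a straddling occurrence the first entry lies in \<open>xs\<close> and exceeds the
  second, which is impossible both in the sorted \<open>xs\<close> and in the larger
  \<open>ys\<close>.\<close>

lemma avoids_213_append_greater:
  assumes "sorted xs" and "avoids_213 ys" and less: "\<And>x y. x \<in> set xs \<Longrightarrow> y \<in> set ys \<Longrightarrow> x < y"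
  shows "avoids_213 (xs @ ys)"
proof -
  have "sorted_wrt (\<lambda>a c. \<not> (a < b \<and> b < c)) ys" if "b \<in> set xs" for b
    by (rule sorted_wrt_if_all) (use less that in force)
  moreover have "sorted_wrt (\<lambda>b a. \<not> (a < b \<and> b < c)) xs" for c
    by (rule sorted_wrt_mono_rel[OF _ assms(1)]) auto
  ultimately show ?thesis
    using assms(1,2) by (simp add: avoids_213_append avoids_213_sorted)
qed

text \<open>A straddling occurrence would have its largest entry in \<open>ys\<close> and a smaller
  one in \<open>xs\<close>.\<close>

lemma avoids_213_append_less:
  assumes "avoids_213 xs" and "sorted ys" and less: "\<And>x y. x \<in> set xs \<Longrightarrow> y \<in> set ys \<Longrightarrow> y < x"
  shows "avoids_213 (xs @ ys)"
proof -
  have "sorted_wrt (\<lambda>a c. \<not> (a < b \<and> b < c)) ys" if "b \<in> set xs" for b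
    by (rule sorted_wrt_if_all) (use less that in force)
  moreover have "sorted_wrt (\<lambda>b a. \<not> (a < b \<and> b < c)) xs" if "c \<in> set ys" for c
    by (rule sorted_wrt_if_all) (use less that in force)
  ultimately show ?thesis
    using assms(1,2) by (simp add: avoids_213_append avoids_213_sorted)
qed

lemma avoids_213_map_strict_mono:
  assumes "strict_mono_on (set xs) f"
  shows "avoids_213 (map f xs) \<longleftrightarrow> avoids_213 xs"
proof -
  have "f x < f y \<longleftrightarrow> x < y" if "x \<in> set xs" "y \<in> set xs" for x y
    using assms that by (rule strict_mono_on_less)
  then show ?thesis
    by (simp add: avoids_213_iff_nth)
qed

text \<open>With \<open>x\<close> standing before \<open>q\<close>, an entry below \<open>x\<close>
  followed by one above it would complete a 213. For \<open>x = t + 1\<close> this makes the later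
  teeth contiguous.\<close>

lemma partition_of_no_rise_through:
  fixes x :: "'a::linorder"
  assumes "sorted_wrt (\<lambda>a c. \<not> (a < x \<and> x < c)) q" and "x \<notin> set q"
  shows "q = filter (\<lambda>y. x < y) q @ filter (\<lambda>y. y < x) q"
  using assms
proof (induction q)
  case (Cons y q)
  show ?case
  proof (cases "x < y")
    case False
    then have "y < x" using Cons.prems by auto
    then have "\<forall>c\<in>set q. \<not> x < c \<and> c \<noteq> x" using Cons.prems by auto
    then have "\<forall>c\<in>set q. c < x" by (meson linorder_less_linear)
    then show ?thesis
      using \<open>y < x\<close> by (auto simp: filter_empty_conv)
  qed (use Cons in auto)
qed simp

lemma linear_extensions_iff_sorted_wrt:
  "v \<in> linear_extensions A r \<longleftrightarrow>
    distinct v \<and> set v = A \<and> sorted_wrt (\<lambda>x y. (y, x) \<notin> r) v"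
proof -
  have "(\<forall>i<length v. \<forall>j<length v. (v ! i, v ! j) \<in> r \<longrightarrow> i \<le> j) \<longleftrightarrow>
      (\<forall>j i. j < i \<longrightarrow> i < length v \<longrightarrow> (v ! i, v ! j) \<notin> r)"
    by (simp flip: not_less) (meson less_trans)
  then show ?thesis
    by (simp add: linear_extensions_def sorted_wrt_iff_nth_less)
qed

section \<open>The comb order\<close>

definition comb_gen :: "nat \<Rightarrow> nat \<Rightarrow> nat rel" where
  "comb_gen s t = comb_spine s t \<union> comb_teeth s t"

text \<open>The first tooth is peeled off: the cases \<open>c = 0\<close> and
  \<open>c = Suc d\<close> in the generators separate its edges from the comb shifted by
  \<open>t\<close>.\<close>

lemma comb_gen_Suc:
  assumes "t \<ge> 1"
  shows "(a, b) \<in> comb_gen (Suc s) t \<longleftrightarrow>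
    (s \<ge> 1 \<and> a = 1 \<and> b = t + 1) \<or> (1 \<le> a \<and> a < t \<and> b = a + 1) \<or>
    (t < a \<and> t < b \<and> (a - t, b - t) \<in> comb_gen s t)" (is "?L \<longleftrightarrow> ?R")
proof
  assume ?L
  then consider
      (spine) c where "a = c * t + 1" "b = (c + 1) * t + 1" "c < s"
    | (tooth) c j where "a = c * t + j" "b = c * t + j + 1" "c < Suc s" "1 \<le> j" "j < t"
    by (auto simp: comb_gen_def comb_spine_def comb_teeth_def)
  then show ?R
  proof cases
    case spine
    show ?thesis
    proof (cases c)
      case (Suc d)
      then have "a - t = d * t + 1" "b - t = (d + 1) * t + 1" "d + 1 < s" "t < a" "t < b"
        using spine by auto
      then show ?thesis by (auto simp: comb_gen_def comb_spine_def)
    qed (use spine in auto)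
  next
    case tooth
    show ?thesis
    proof (cases c)
      case (Suc d)
      then have "a - t = d * t + j" "b - t = d * t + j + 1" "d < s" "t < a" "t < b"
        using tooth by auto
      then show ?thesis using tooth by (auto simp: comb_gen_def comb_teeth_def)
    qed (use tooth in auto)
  qed
next
  assume ?R
  \<comment> \<open>The term \<open>0 * t\<close> exhibits the witness \<open>c = 0\<close> in the
    form used by the generator sets.\<close>
  then consider "s \<ge> 1" "a = 0 * t + 1" "b = (0 + 1) * t + 1"
    | "1 \<le> a" "a < t" "a = 0 * t + a" "b = 0 * t + a + 1"
    | (shift) "t < a" "t < b" "(a - t, b - t) \<in> comb_gen s t"
    by auto
  then show ?L
  proof cases
    case shift
    from shift(3) consider
        (spine) c where "a - t = c * t + 1" "b - t = (c + 1) * t + 1" "c + 1 < s"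
      | (tooth) c j where "a - t = c * t + j" "b - t = c * t + j + 1" "c < s" "1 \<le> j" "j < t"
      by (auto simp: comb_gen_def comb_spine_def comb_teeth_def)
    then show ?thesis
    proof cases
      case spine
      then have "a = Suc c * t + 1" "b = (Suc c + 1) * t + 1" "Suc c + 1 < Suc s"
        using shift by auto
      then show ?thesis unfolding comb_gen_def comb_spine_def by blast
    next
      case tooth
      then have "a = Suc c * t + j" "b = Suc c * t + j + 1" "Suc c < Suc s"
        using shift by auto
      with tooth(4,5) show ?thesis unfolding comb_gen_def comb_teeth_def by blast
    qed
  next
    case 1
    then have "0 + 1 < Suc s" by simp
    with 1 show ?thesis unfolding comb_gen_def comb_spine_def by blast
  next
    case 2
    then show ?thesis unfolding comb_gen_def comb_teeth_def by blast
  qed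
qed

text \<open>A path leaves the first tooth only by the spine edge from 1. Generators strictly
  increase, so a path from \<open>a \<ge> 1\<close> visits 1 only if it starts there.\<close>

lemma comb_gen_Suc_rtranclD:
  assumes "t \<ge> 1" and "(a, b) \<in> (comb_gen (Suc s) t)\<^sup>*" and "a \<ge> 1"
  shows "a \<le> b \<and> (b \<le> t \<or> a = 1 \<or> (t < a \<and> (a - t, b - t) \<in> (comb_gen s t)\<^sup>*))"
  using assms(2)
proof (induction rule: rtrancl_induct)
  case (step b c)
  from step.hyps(2) have "b < c"
    using assms(1) by (auto simp: comb_gen_def comb_spine_def comb_teeth_def)
  with step show ?case
    using assms(1,3) by (auto simp: comb_gen_Suc intro: rtrancl_into_rtrancl)
qed (use assms in auto)

lemma comb_gen_rtrancl_tooth: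
  assumes "t \<ge> 1" and "1 \<le> a" and "a \<le> b" and "b \<le> t"
  shows "(a, b) \<in> (comb_gen (Suc s) t)\<^sup>*"
  using assms(3,4)
proof (induction b rule: dec_induct)
  case (step n)
  then have "(n, Suc n) \<in> comb_gen (Suc s) t"
    using assms(1,2) by (simp add: comb_gen_Suc)
  then show ?case
    using step by (meson Suc_leD rtrancl_into_rtrancl)
qed simp

text \<open>The bound \<open>b \<ge> 1\<close> is carried through the induction because the next
  shifted edge must start beyond \<open>t\<close>.\<close>

lemma comb_gen_rtrancl_shift:
  assumes "t \<ge> 1" and "(a, b) \<in> (comb_gen s t)\<^sup>*" and "a \<ge> 1"
  shows "(a + t, b + t) \<in> (comb_gen (Suc s) t)\<^sup>* \<and> b \<ge> 1"
  using assms(2)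
proof (induction rule: rtrancl_induct)
  case (step b c)
  then have "c \<ge> 1" by (auto simp: comb_gen_def comb_spine_def comb_teeth_def)
  then have "(b + t, c + t) \<in> comb_gen (Suc s) t"
    using step assms(1) by (auto simp: comb_gen_Suc)
  with step \<open>c \<ge> 1\<close> show ?case by (meson rtrancl_into_rtrancl)
qed (use assms in auto)

text \<open>From 1 one either climbs the first tooth or takes the spine edge to
  \<open>t + 1\<close>, the least element of the shifted smaller comb.\<close>

lemma comb_gen_rtrancl_least:
  assumes "t \<ge> 1" and "1 \<le> b" and "b \<le> s * t"
  shows "(1, b) \<in> (comb_gen s t)\<^sup>*"
  using assms(2,3)
proof (induction s arbitrary: b)
  case (Suc s)
  show ?case
  proof (cases "b \<le> t")
    case False
    then have b: "1 \<le> b - t" "b - t \<le> s * t" using Suc.prems by auto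
    then have "s \<ge> 1" by (cases s) auto
    then have "(1, 1 + t) \<in> comb_gen (Suc s) t"
      using assms(1) by (simp add: comb_gen_Suc)
    moreover have "(1 + t, b) \<in> (comb_gen (Suc s) t)\<^sup>*"
      using comb_gen_rtrancl_shift[OF assms(1) Suc.IH[OF b]] False by simp
    ultimately show ?thesis by (rule converse_rtrancl_into_rtrancl)
  qed (use Suc.prems assms(1) comb_gen_rtrancl_tooth in blast)
qed simp

text \<open>This turns most later questions about paths into arithmetic and a recursion on the
  number of teeth.\<close>

lemma comb_le_Suc_iff:
  assumes "t \<ge> 1"
  shows "(a, b) \<in> comb_le (Suc s) t \<longleftrightarrow>
    1 \<le> a \<and> b \<le> t + s * t \<and> a \<le> b \<and> (b \<le> t \<or> a = 1 \<or> (t < a \<and> (a - t, b - t) \<in> comb_le s t))"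
    (is "?L \<longleftrightarrow> ?R")
proof
  assume ?L
  then have ab: "a \<in> {1..t + s * t}" "b \<in> {1..t + s * t}" "(a, b) \<in> (comb_gen (Suc s) t)\<^sup>*"
    by (auto simp: comb_le_def comb_carrier_def comb_gen_def)
  then show ?R
    using comb_gen_Suc_rtranclD[OF assms ab(3)]
    by (auto simp: comb_le_def comb_carrier_def comb_gen_def)
next
  assume R: ?R
  then have "(a, b) \<in> (comb_gen (Suc s) t)\<^sup>*"
    using comb_gen_rtrancl_tooth[OF assms, of a b s] comb_gen_rtrancl_least[OF assms, of b "Suc s"]
      comb_gen_rtrancl_shift[OF assms, of "a - t" "b - t" s]
    by (auto simp: comb_le_def comb_gen_def)
  with R show ?L
    by (auto simp: comb_le_def comb_carrier_def comb_gen_def)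
qed

section \<open>Adding a tooth\<close>

definition avoiders :: "nat \<Rightarrow> nat \<Rightarrow> nat list set" where
  "avoiders s t = {v \<in> linear_extensions (comb_carrier s t) (comb_le s t). avoids_213 v}"

lemma avoiders_iff:
  "v \<in> avoiders s t \<longleftrightarrow> distinct v \<and> set v = {1..s * t} \<and>
    sorted_wrt (\<lambda>x y. (y, x) \<notin> comb_le s t) v \<and> avoids_213 v"
  by (auto simp: avoiders_def linear_extensions_iff_sorted_wrt comb_carrier_def)

definition insert_tooth :: "nat \<Rightarrow> nat \<Rightarrow> nat list \<Rightarrow> nat list" where
  "insert_tooth t k w = [1..<Suc k] @ map (\<lambda>x. x + t) w @ [Suc k..<Suc t]"

text \<open>Since \<open>k \<ge> 1\<close>, the entry 1 precedes the shifted block, and it is the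
  only first-tooth entry comparable to that block. For avoidance, smaller increasing entries are
  appended to the block, then still smaller or equally harmless ones are prepended:
  \<open>1, ..., k\<close> lie below all that follows.\<close>

lemma insert_tooth_in_avoiders:
  assumes "1 \<le> k" and "k \<le> t" and "w \<in> avoiders s t"
  shows "insert_tooth t k w \<in> avoiders (Suc s) t"
proof -
  have t: "t \<ge> 1" using assms by simp
  have w: "distinct w" "set w = {1..s * t}" "sorted_wrt (\<lambda>x y. (y, x) \<notin> comb_le s t) w"
    "avoids_213 w"
    using assms(3) by (auto simp: avoiders_iff)
  have img: "(\<lambda>x. x + t) ` set w = {Suc t..t + s * t}"
    unfolding w(2) by (simp add: image_add_atLeastAtMost' add.commute)
  have upt: "sorted_wrt (\<lambda>x y. (y, x) \<notin> comb_le (Suc s) t) [i..<j]" for i j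
    by (rule sorted_wrt_mono_rel[OF _ sorted_wrt_upt]) (auto simp: comb_le_Suc_iff[OF t])
  have mid: "sorted_wrt (\<lambda>x y. (y, x) \<notin> comb_le (Suc s) t) (map (\<lambda>x. x + t) w)"
    unfolding sorted_wrt_map
    by (rule sorted_wrt_mono_rel[OF _ w(3)]) (use t w(2) in \<open>auto simp: comb_le_Suc_iff\<close>)
  have av: "avoids_213 (map (\<lambda>x. x + t) w)"
    using w(4) by (simp add: avoids_213_map_strict_mono strict_mono_on_def)
  have less_img: "t < x" if "x \<in> set (map (\<lambda>x. x + t) w)" for x
    using that img by auto
  have tail: "avoids_213 (map (\<lambda>x. x + t) w @ [Suc k..<Suc t])"
    by (rule avoids_213_append_less[OF av sorted_upt]) (use less_img in fastforce)
  show ?thesis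
    unfolding avoiders_iff insert_tooth_def
  proof (intro conjI)
    show "distinct ([1..<Suc k] @ map (\<lambda>x. x + t) w @ [Suc k..<Suc t])"
      using w(1) img assms by (auto simp: distinct_map)
    show "set ([1..<Suc k] @ map (\<lambda>x. x + t) w @ [Suc k..<Suc t]) = {1..Suc s * t}"
      unfolding set_append set_map img set_upt using assms(1,2) by auto
    show "sorted_wrt (\<lambda>x y. (y, x) \<notin> comb_le (Suc s) t)
        ([1..<Suc k] @ map (\<lambda>x. x + t) w @ [Suc k..<Suc t])"
      unfolding sorted_wrt_append
      by (intro conjI upt mid) (use t assms img in \<open>auto simp: comb_le_Suc_iff\<close>)
    show "avoids_213 ([1..<Suc k] @ map (\<lambda>x. x + t) w @ [Suc k..<Suc t])"
      by (rule avoids_213_append_greater[OF sorted_upt tail])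
        (use less_img assms(1,2) in \<open>fastforce simp del: upt_Suc set_map\<close>)
  qed
qed

section \<open>Removing the first tooth\<close>

text \<open>The first tooth is a chain, so its entries appear in increasing order.\<close>

lemma filter_first_tooth:
  assumes "t \<ge> 1" and "v \<in> avoiders (Suc s) t"
  shows "filter (\<lambda>x. x \<le> t) v = [1..<Suc t]"
proof -
  have v: "distinct v" "set v = {1..t + s * t}" "sorted_wrt (\<lambda>x y. (y, x) \<notin> comb_le (Suc s) t) v"
    using assms(2) by (auto simp: avoiders_iff)
  have "sorted_wrt (\<lambda>x y. (y, x) \<notin> comb_le (Suc s) t) (filter (\<lambda>x. x \<le> t) v)"
    using v(3) by (rule sorted_wrt_filter)
  then have "sorted (filter (\<lambda>x. x \<le> t) v)"
    by (rule sorted_wrt_mono_rel[rotated]) (use v(2) assms(1) in \<open>auto simp: comb_le_Suc_iff\<close>)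
  then show ?thesis
    by (rule sorted_distinct_set_unique[OF _ _ sorted_upt distinct_upt]) (use v in auto)
qed

lemma avoiders_Suc_decompose:
  assumes "t \<ge> 1" and "s \<ge> 1" and "v \<in> avoiders (Suc s) t"
  obtains k w where "1 \<le> k" "k \<le> t" "w \<in> avoiders s t" "v = insert_tooth t k w"
proof -
  have v: "distinct v" "set v = {1..t + s * t}" "sorted_wrt (\<lambda>x y. (y, x) \<notin> comb_le (Suc s) t) v"
    "avoids_213 v"
    using assms(3) by (auto simp: avoiders_iff)
  \<comment> \<open>A second tooth exists because \<open>s \<ge> 1\<close>, so \<open>t + 1\<close>
    does occur in \<open>v\<close>.\<close>
  have "t \<le> s * t" using assms by simp
  then have "Suc t \<in> set v" using assms(1) v(2) by simp
  then obtain p q where pq: "v = p @ Suc t # q" by (meson split_list)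
  \<comment> \<open>Every entry beyond \<open>t\<close> lies above \<open>t + 1\<close> in the comb
    order, hence cannot precede it.\<close>
  have p: "x \<le> t" if x: "x \<in> set p" for x
  proof (rule ccontr)
    assume "\<not> x \<le> t"
    have xv: "x \<in> {1..t + s * t}" unfolding v(2)[symmetric] pq using x by simp
    with \<open>\<not> x \<le> t\<close> have "1 \<le> x - t" "x - t \<le> s * t" by auto
    then have "(1, x - t) \<in> comb_le s t"
      using comb_gen_rtrancl_least[OF assms(1), of "x - t" s] assms(1,2)
      by (auto simp: comb_le_def comb_carrier_def comb_gen_def)
    then have "(Suc t, x) \<in> comb_le (Suc s) t"
      using \<open>\<not> x \<le> t\<close> xv assms(1) by (auto simp: comb_le_Suc_iff)
    then show False using v(3) x pq by (auto simp: sorted_wrt_append)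
  qed
  define m r where "m = Suc t # filter (\<lambda>y. Suc t < y) q" and "r = filter (\<lambda>y. y < Suc t) q"
  have "q = filter (\<lambda>y. Suc t < y) q @ r"
    unfolding r_def
    by (rule partition_of_no_rise_through) (use v pq in \<open>auto simp: avoids_213_append\<close>)
  then have pmr: "v = p @ m @ r" unfolding pq m_def by simp
  have m: "x > t" if "x \<in> set m" for x using that by (auto simp: m_def)
  have r: "x \<le> t" if "x \<in> set r" for x using that by (auto simp: r_def)
  define k w where "k = length p" and "w = map (\<lambda>x. x - t) m"
  \<comment> \<open>Deleting the block \<open>m\<close> from \<open>v\<close> leaves exactly the
    first-tooth entries.\<close>
  have "p @ r = [1..<Suc t]"
  proof -
    have "filter (\<lambda>x. x \<le> t) p = p" "filter (\<lambda>x. x \<le> t) r = r" "filter (\<lambda>x. x \<le> t) m = []"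
      using p r m by (fastforce simp: filter_id_conv filter_empty_conv)+
    then show ?thesis using filter_first_tooth[OF assms(1,3)] pmr by simp
  qed
  then have k_le: "k \<le> t" and pk: "p = [1..<Suc k]" and rk: "r = [Suc k..<Suc t]"
  proof -
    assume eq: "p @ r = [1..<Suc t]"
    then have "length (p @ r) = t" by simp
    then show "k \<le> t" by (simp add: k_def)
    then have "[1..<Suc t] = [1..<Suc k] @ [Suc k..<Suc t]"
      using upt_add_eq_append[of 1 "Suc k" "t - k"] by simp
    with eq show "p = [1..<Suc k]" "r = [Suc k..<Suc t]"
      by (simp_all add: append_eq_append_conv k_def del: upt_Suc)
  qed
  have mw: "m = map (\<lambda>x. x + t) w"
    unfolding w_def using m by (auto simp: map_idI less_imp_le)
  \<comment> \<open>Otherwise 1 would follow \<open>t + 1\<close>, the head of \<open>m\<close>,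
    against the spine relation.\<close>
  have "k \<ge> 1"
  proof (rule ccontr)
    assume "\<not> k \<ge> 1"
    then have "1 \<in> set r" using rk assms(1) by auto
    moreover have "(1, Suc t) \<in> comb_le (Suc s) t"
      using assms \<open>t \<le> s * t\<close> by (simp add: comb_le_Suc_iff)
    ultimately show False
      using v(3) unfolding pmr m_def by (auto simp: sorted_wrt_append)
  qed
  have "w \<in> avoiders s t"
    unfolding avoiders_iff
  proof (intro conjI)
    show "distinct w" using v(1) pmr mw by (simp add: distinct_map)
    have "set m = {x \<in> set v. t < x}"
      using p m r by (fastforce simp: pmr)
    also have "\<dots> = {t + 1..t + s * t}" unfolding v(2) by auto
    finally have sm: "set m = {1 + t..s * t + t}" by (simp add: add.commute)
    have "set m = (\<lambda>x. x + t) ` {1..s * t}"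
      unfolding sm by (simp add: image_add_atLeastAtMost')
    then have "set w = (\<lambda>x. x - t) ` (\<lambda>x. x + t) ` {1..s * t}"
      by (simp add: w_def)
    then show sw: "set w = {1..s * t}" by (simp only: image_image add_diff_cancel_right' image_ident)
    have "sorted_wrt (\<lambda>x y. (y + t, x + t) \<notin> comb_le (Suc s) t) w"
      using v(3) unfolding pmr mw sorted_wrt_append sorted_wrt_map by blast
    then show "sorted_wrt (\<lambda>x y. (y, x) \<notin> comb_le s t) w"
    proof (rule sorted_wrt_mono_rel[rotated])
      fix x y
      assume xy: "x \<in> set w" "y \<in> set w" "(y + t, x + t) \<notin> comb_le (Suc s) t"
      \<comment> \<open>The characterization of the larger order also demands this numerical
        inequality.\<close>
      have "y \<le> x" if "(y, x) \<in> comb_le s t"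
      proof -
        obtain s' where "s = Suc s'" using assms(2) by (cases s) auto
        with that assms(1) show ?thesis by (simp add: comb_le_Suc_iff)
      qed
      with xy show "(y, x) \<notin> comb_le s t"
        using assms(1) unfolding sw by (auto simp: comb_le_Suc_iff)
    qed
    show "avoids_213 w"
      using v(4) unfolding pmr mw
      by (simp add: avoids_213_append avoids_213_map_strict_mono strict_mono_on_def)
  qed
  moreover have "v = insert_tooth t k w"
    unfolding insert_tooth_def pmr mw[symmetric] pk[symmetric] rk[symmetric] by simp
  ultimately show thesis using that \<open>k \<ge> 1\<close> k_le by blast
qed

section \<open>Counting by the number of teeth\<close>

text \<open>The inverse reads \<open>k\<close> off the initial run of entries at most
  \<open>t\<close>. That run stops at \<open>k\<close> because \<open>s \<ge> 1\<close> makes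
  \<open>w\<close> nonempty; for \<open>s = 0\<close> every \<open>k\<close> would give the same
  list.\<close>

lemma inj_on_insert_tooth:
  assumes "t \<ge> 1" and "s \<ge> 1"
  shows "inj_on (\<lambda>(k, w). insert_tooth t k w) ({1..t} \<times> avoiders s t)"
proof (rule inj_on_inverseI[where g = "\<lambda>v. (length (takeWhile (\<lambda>x. x \<le> t) v),
    map (\<lambda>x. x - t) (filter (\<lambda>x. t < x) v))"])
  fix kw
  assume "kw \<in> {1..t} \<times> avoiders s t"
  then obtain k w where kw: "kw = (k, w)" and k: "k \<in> {1..t}" and w: "w \<in> avoiders s t"
    by blast
  then have sw: "set w = {1..s * t}" by (simp add: avoiders_iff)
  then obtain x w' where xw: "w = x # w'" using assms by (cases w) auto
  have "takeWhile (\<lambda>x. x \<le> t) (insert_tooth t k w) = [1..<Suc k]"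
  proof -
    have "x \<ge> 1" using sw xw by auto
    then have "takeWhile (\<lambda>x. x \<le> t) (map (\<lambda>x. x + t) w @ [Suc k..<Suc t]) = []"
      by (simp add: xw)
    then show ?thesis
      unfolding insert_tooth_def using k by (subst takeWhile_append2) auto
  qed
  moreover have "filter (\<lambda>x. t < x) (insert_tooth t k w) = map (\<lambda>x. x + t) w"
  proof -
    have "filter (\<lambda>x. t < x) [1..<Suc k] = []" "filter (\<lambda>x. t < x) [Suc k..<Suc t] = []"
      using k by (auto simp: filter_empty_conv)
    moreover have "filter (\<lambda>x. t < x) (map (\<lambda>x. x + t) w) = map (\<lambda>x. x + t) w"
      using sw by (auto simp: filter_id_conv)
    ultimately show ?thesis by (simp add: insert_tooth_def del: upt_Suc)
  qed
  ultimately show "(length (takeWhile (\<lambda>x. x \<le> t) (case kw of (k, w) \<Rightarrow> insert_tooth t k w)),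
      map (\<lambda>x. x - t) (filter (\<lambda>x. t < x) (case kw of (k, w) \<Rightarrow> insert_tooth t k w))) = kw"
    by (simp add: kw comp_def)
qed

lemma card_avoiders_Suc:
  assumes "t \<ge> 1" and "s \<ge> 1"
  shows "card (avoiders (Suc s) t) = t * card (avoiders s t)"
proof -
  have "avoiders (Suc s) t = (\<lambda>(k, w). insert_tooth t k w) ` ({1..t} \<times> avoiders s t)"
    (is "_ = ?f ` ?A")
  proof
    show "avoiders (Suc s) t \<subseteq> ?f ` ?A"
    proof
      fix v
      assume "v \<in> avoiders (Suc s) t"
      then obtain k w where "1 \<le> k" "k \<le> t" "w \<in> avoiders s t" "v = insert_tooth t k w"
        using avoiders_Suc_decompose[OF assms] by blast
      then show "v \<in> ?f ` ?A" by (intro image_eqI[of _ _ "(k, w)"]) auto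
    qed
    show "?f ` ?A \<subseteq> avoiders (Suc s) t"
      using insert_tooth_in_avoiders by auto
  qed
  then show ?thesis
    using card_image[OF inj_on_insert_tooth[OF assms]] by (simp add: card_cartesian_product)
qed

lemma avoiders_1:
  assumes "t \<ge> 1"
  shows "avoiders 1 t = {[1..<Suc t]}"
proof -
  have "[] \<in> avoiders 0 t" by (simp add: avoiders_iff)
  \<comment> \<open>The single tooth arises by insertion into the empty list with
    \<open>k = t\<close>.\<close>
  from insert_tooth_in_avoiders[OF assms order_refl this]
  have "[1..<Suc t] \<in> avoiders 1 t" by (simp add: insert_tooth_def)
  moreover have "v = [1..<Suc t]" if "v \<in> avoiders 1 t" for v
  proof -
    have "filter (\<lambda>x. x \<le> t) v = v"
      using that by (auto simp: avoiders_iff filter_id_conv)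
    then show ?thesis using filter_first_tooth[OF assms, of v 0] that by simp
  qed
  ultimately show ?thesis by blast
qed

theorem theorem9:
  fixes s t :: nat
  assumes "s \<ge> 1" and "t \<ge> 1"
  shows "card {v \<in> linear_extensions (comb_carrier s t) (comb_le s t).
                avoids_pattern3 v [2, 1, 3]} = t ^ (s - 1)"
proof -
  have "card (avoiders s t) = t ^ (s - 1)"
    using assms(1)
  proof (induction s rule: dec_induct)
    case base
    show ?case using avoiders_1[OF assms(2)] by simp
  next
    case (step s)
    \<comment> \<open>The bound \<open>s \<ge> 1\<close> keeps the subtraction from
      truncating.\<close>
    have "t ^ s = t * t ^ (s - 1)" using step.hyps(1) by (simp flip: power_Suc)
    then show ?case using card_avoiders_Suc[OF assms(2) step.hyps(1)] step.IH by simp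
  qed
  then show ?thesis unfolding avoiders_def avoids_pattern3_213 .
qed

end
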